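(* Let $x\in W\rtimes\langle\delta\rangle$ and let $\underline{\theta}=(\theta_1,\ldots,\theta_r)$ be a $\Phi$-admissible sequence for $x$. If $x$ is at good position with respect to $(\Phi^+,\underline{\theta})$, then $x$ is convex for $\Phi^+$ and $\Phi(x)=\Phi^x$, where $\Phi^x=\{\alpha\in\Phi : x(\alpha)=\alpha\}$.
   Context: $G$ is a reductive group over an algebraically closed field, $T\subseteq G$ a maximal torus, $B\supseteq T$ a Borel subgroup, $W=N_T/T$ the Weyl group ($N_T$ the normalizer of $T$ in $G$). $\Phi$ is the root system of $T$ in $G$, $\Phi^+$ the set of positive roots determined by $B$, $\Phi^-=-\Phi^+$, $\Delta$ the set of simple roots, $\mathbb{S}$ the set of simple reflections. $\delta$ is an automorphism of $G$ preserving $T$ and $B$; the induced automorphisms of $(W,\mathbb{S})$, $\Phi$, $\Phi^+$, $\Delta$ are also denoted $\delta$. For $x\in W\rtimes\langle\delta\rangle$ put $\Phi^\pm(x)=\{\gamma\in\Phi^\pm : x^i(\gamma)\in\Phi^\pm\text{ for all }i\in\mathbb{Z}\}$ and $\Phi(x)=\Phi^+(x)\sqcup\Phi^-(x)$. For $\gamma\in\Phi^\pm\setminus\Phi(x)$ put $n_x(\gamma)=\min\{i\in\mathbb{Z}_{\geq1} : x^i(\gamma)\in\Phi^\mp\}$, and $n_x(\gamma)=\infty$ for $\gamma\in\Phi(x)$. The element $x$ is quasi-convex (for $\Phi^+$) if (i) $\Phi(x)$ is a standard parabolic root subsystem, i.e. $\Phi(x)=\Phi\cap\mathbb{Z}J$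 for some $J\subseteq\Delta$; and (ii) $n_x(\alpha+\beta)\leq\max\{n_x(\alpha),n_x(\beta)\}$ for all $\alpha,\beta\in\Phi^+$ with $\alpha+\beta\in\Phi^+$. It is convex (for $\Phi^+$) if both $x$ and $x^{-1}$ are quasi-convex. $V=\mathbb{R}\Phi$ is a Euclidean space with an inner product $(-,-)$ preserved by $W\rtimes\langle\delta\rangle$; $C_0=\{v\in V:(v,\alpha)>0\text{ for all }\alpha\in\Phi^+\}$ is the dominant Weyl chamber, $\overline{C_0}$ its closure, and $H_\gamma=\{v\in V:(v,\gamma)=0\}$ for $\gamma\in\Phi$. For a linear subspace $K\subseteq V$, a point $e\in K$ is $\Phi$-regular in $K$ if for every $\gamma\in\Phi$, $e\in H_\gamma$ implies $K\subseteq H_\gamma$. For $0\leq\theta\leq\pi$ let $V_x^\theta=\{v\in V:x(v)+x^{-1}(v)=2\cos\theta\cdot v\}$, so $V=\bigoplus_{0\leq\theta\leq\pi}V_x^\theta$ orthogonally; let $V^x=\{v\in V:x(v)=v\}$. A sequence $\underline\theta=(\theta_1,\dots,\theta_r)$ in $(0,\pi]$ is $\Phi$-admissible for $x$ if $\sum_{j=1}^rV_x^{\theta_j}$ contains a $\Phi$-regular point of $(V^x)^\perp=\bigoplus_{0<\theta\leq\pi}V_x^\theta$; by convention the empty sequence is $\Phi$-admissible for $x$ if and only if $x=1$. For a $\Phi$-admissible sequence $\underline\theta$, $x$ is at good position with respect to $(\Phi^+,\underline\theta)$ if for each $1\leq i\leq r$, $\overline{C_0}$ contains some $\Phi$-regular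 point of $\sum_{j=1}^iV_x^{\theta_j}$. *)

theory Defs
  imports "HOL-Analysis.Analysis"
begin

text \<open>
  A based root system \<open>(\<Phi>, P)\<close> with an automorphism \<open>\<delta>\<close>, as attached to a reductive group \<open>G\<close>
  with \<open>T \<subseteq> B\<close> and a \<open>(T, B)\<close>-preserving automorphism of \<open>G\<close>. The root system lies in an ambient
  Euclidean space whose inner product restricts to the chosen invariant one on
  \<open>V = span \<Phi>\<close>. The span is not required to be everything: types of class
  \<open>euclidean_space\<close> have positive dimension, while \<open>\<Phi>\<close> is empty when \<open>G\<close> is a torus.
\<close>

definition root_reflection :: "'v::euclidean_space \<Rightarrow> 'v \<Rightarrow> 'v" where
  "root_reflection \<alpha> v = v - (2 * (v \<bullet> \<alpha>) / (\<alpha> \<bullet> \<alpha>)) *\<^sub>R \<alpha>"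

definition root_system :: "'v::euclidean_space set \<Rightarrow> bool" where
  "root_system \<Phi> \<longleftrightarrow>
     finite \<Phi> \<and> 0 \<notin> \<Phi> \<and>
     (\<forall>\<alpha>\<in>\<Phi>. root_reflection \<alpha> ` \<Phi> = \<Phi>) \<and>
     (\<forall>\<alpha>\<in>\<Phi>. \<forall>\<beta>\<in>\<Phi>. 2 * (\<beta> \<bullet> \<alpha>) / (\<alpha> \<bullet> \<alpha>) \<in> \<int>) \<and>
     (\<forall>\<alpha>\<in>\<Phi>. \<forall>c::real. c *\<^sub>R \<alpha> \<in> \<Phi> \<longrightarrow> c = 1 \<or> c = -1)"

definition positive_system :: "'v::euclidean_space set \<Rightarrow> 'v set \<Rightarrow> bool" where
  "positive_system \<Phi> P \<longleftrightarrow>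
     (\<exists>\<rho>\<in>span \<Phi>. (\<forall>\<alpha>\<in>\<Phi>. \<rho> \<bullet> \<alpha> \<noteq> 0) \<and> P = {\<alpha>\<in>\<Phi>. \<rho> \<bullet> \<alpha> > 0})"

definition simple_roots :: "'v::euclidean_space set \<Rightarrow> 'v set" where
  "simple_roots P = {\<alpha>\<in>P. \<nexists>\<beta> \<gamma>. \<beta> \<in> P \<and> \<gamma> \<in> P \<and> \<alpha> = \<beta> + \<gamma>}"

text \<open>
  An isometry of \<open>span \<Phi>\<close> extends by the identity on the orthogonal complement, so taking \<open>\<delta>\<close> to
  be an isometry of the ambient space is no restriction. Its values off \<open>span \<Phi>\<close> are never used.
\<close>

definition based_automorphism ::
    "'v::euclidean_space set \<Rightarrow> 'v set \<Rightarrow> ('v \<Rightarrow> 'v) \<Rightarrow> bool" where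
  "based_automorphism \<Phi> P \<delta> \<longleftrightarrow> orthogonal_transformation \<delta> \<and> \<delta> ` \<Phi> = \<Phi> \<and> \<delta> ` P = P"

inductive_set weyl_group :: "'v::euclidean_space set \<Rightarrow> ('v \<Rightarrow> 'v) set" for \<Phi> where
  weyl_id: "id \<in> weyl_group \<Phi>"
| weyl_step: "\<alpha> \<in> \<Phi> \<Longrightarrow> w \<in> weyl_group \<Phi> \<Longrightarrow> root_reflection \<alpha> \<circ> w \<in> weyl_group \<Phi>"

text \<open>Integer iterates, meant for bijections.\<close>

definition zpow :: "('v \<Rightarrow> 'v) \<Rightarrow> int \<Rightarrow> 'v \<Rightarrow> 'v" where
  "zpow x i = (if 0 \<le> i then x ^^ nat i else inv x ^^ nat (- i))"

text \<open>
  The group \<open>W \<rtimes> \<langle>\<delta>\<rangle>\<close>, given by its action on \<open>V\<close>. The action is faithful for \<open>\<delta>\<close> viewed as an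
  automorphism of \<open>\<Phi>\<close>, because only \<open>1 \<in> W\<close> preserves \<open>P\<close>.
\<close>

definition twisted_weyl_group ::
    "'v::euclidean_space set \<Rightarrow> ('v \<Rightarrow> 'v) \<Rightarrow> ('v \<Rightarrow> 'v) set" where
  "twisted_weyl_group \<Phi> \<delta> = {w \<circ> zpow \<delta> i | w i. w \<in> weyl_group \<Phi>}"

text \<open>
  \<open>stable_roots P x\<close> is \<open>\<Phi>\<^sup>+(x)\<close>; replacing \<open>P\<close> by \<open>- P\<close> gives \<open>\<Phi>\<^sup>-(x)\<close>.
\<close>

definition stable_roots :: "'v::euclidean_space set \<Rightarrow> ('v \<Rightarrow> 'v) \<Rightarrow> 'v set" where
  "stable_roots P x = {\<gamma>\<in>P. \<forall>i. zpow x i \<gamma> \<in> P}"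

definition Phi_of :: "'v::euclidean_space set \<Rightarrow> ('v \<Rightarrow> 'v) \<Rightarrow> 'v set" where
  "Phi_of P x = stable_roots P x \<union> stable_roots (uminus ` P) x"

definition n_of :: "'v::euclidean_space set \<Rightarrow> ('v \<Rightarrow> 'v) \<Rightarrow> 'v \<Rightarrow> enat" where
  "n_of P x \<gamma> =
     (if \<gamma> \<in> Phi_of P x then \<infinity>
      else enat (LEAST i::nat. 1 \<le> i \<and>
             (\<gamma> \<in> P \<and> (x ^^ i) \<gamma> \<in> uminus ` P \<or> \<gamma> \<in> uminus ` P \<and> (x ^^ i) \<gamma> \<in> P)))"

definition int_span :: "'v::euclidean_space set \<Rightarrow> 'v set" where
  "int_span J = {\<Sum>\<beta>\<in>J. of_int (c \<beta>) *\<^sub>R \<beta> | c :: 'v \<Rightarrow> int. True}"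

definition standard_parabolic_subsystem ::
    "'v::euclidean_space set \<Rightarrow> 'v set \<Rightarrow> 'v set \<Rightarrow> bool" where
  "standard_parabolic_subsystem \<Phi> P \<Psi> \<longleftrightarrow> (\<exists>J\<subseteq>simple_roots P. \<Psi> = \<Phi> \<inter> int_span J)"

definition quasi_convex ::
    "'v::euclidean_space set \<Rightarrow> 'v set \<Rightarrow> ('v \<Rightarrow> 'v) \<Rightarrow> bool" where
  "quasi_convex \<Phi> P x \<longleftrightarrow>
     standard_parabolic_subsystem \<Phi> P (Phi_of P x) \<and>
     (\<forall>\<alpha>\<in>P. \<forall>\<beta>\<in>P. \<alpha> + \<beta> \<in> P \<longrightarrow> n_of P x (\<alpha> + \<beta>) \<le> max (n_of P x \<alpha>) (n_of P x \<beta>))"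

definition convex_element ::
    "'v::euclidean_space set \<Rightarrow> 'v set \<Rightarrow> ('v \<Rightarrow> 'v) \<Rightarrow> bool" where
  "convex_element \<Phi> P x \<longleftrightarrow> quasi_convex \<Phi> P x \<and> quasi_convex \<Phi> P (inv x)"

definition dominant_chamber :: "'v::euclidean_space set \<Rightarrow> 'v set \<Rightarrow> 'v set" where
  "dominant_chamber \<Phi> P = {v\<in>span \<Phi>. \<forall>\<alpha>\<in>P. v \<bullet> \<alpha> > 0}"

definition root_hyperplane :: "'v::euclidean_space set \<Rightarrow> 'v \<Rightarrow> 'v set" where
  "root_hyperplane \<Phi> \<gamma> = {v\<in>span \<Phi>. v \<bullet> \<gamma> = 0}"

definition regular_point :: "'v::euclidean_space set \<Rightarrow> 'v set \<Rightarrow> 'v \<Rightarrow> bool" where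
  "regular_point \<Phi> K e \<longleftrightarrow>
     e \<in> K \<and> (\<forall>\<gamma>\<in>\<Phi>. e \<in> root_hyperplane \<Phi> \<gamma> \<longrightarrow> K \<subseteq> root_hyperplane \<Phi> \<gamma>)"

definition angle_space ::
    "'v::euclidean_space set \<Rightarrow> ('v \<Rightarrow> 'v) \<Rightarrow> real \<Rightarrow> 'v set" where
  "angle_space \<Phi> x \<theta> = {v\<in>span \<Phi>. x v + inv x v = (2 * cos \<theta>) *\<^sub>R v}"

definition fixed_space :: "'v::euclidean_space set \<Rightarrow> ('v \<Rightarrow> 'v) \<Rightarrow> 'v set" where
  "fixed_space \<Phi> x = {v\<in>span \<Phi>. x v = v}"

text \<open>Sums of subspaces are Minkowski sums of sets; the empty sum is \<open>{0}\<close>.\<close>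

definition angle_sum ::
    "'v::euclidean_space set \<Rightarrow> ('v \<Rightarrow> 'v) \<Rightarrow> real list \<Rightarrow> 'v set" where
  "angle_sum \<Phi> x \<theta>s = (\<Sum>\<theta>\<leftarrow>\<theta>s. angle_space \<Phi> x \<theta>)"

definition admissible ::
    "'v::euclidean_space set \<Rightarrow> ('v \<Rightarrow> 'v) \<Rightarrow> real list \<Rightarrow> bool" where
  "admissible \<Phi> x \<theta>s \<longleftrightarrow>
     set \<theta>s \<subseteq> {0<..pi} \<and>
     (if \<theta>s = [] then \<forall>v\<in>span \<Phi>. x v = v
      else \<exists>e\<in>angle_sum \<Phi> x \<theta>s. regular_point \<Phi> (span \<Phi> \<inter> (fixed_space \<Phi> x)\<^sup>\<bottom>) e)"

definition good_position ::
    "'v::euclidean_space set \<Rightarrow> 'v set \<Rightarrow> ('v \<Rightarrow> 'v) \<Rightarrow> real list \<Rightarrow> bool" where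
  "good_position \<Phi> P x \<theta>s \<longleftrightarrow>
     (\<forall>i\<in>{1..length \<theta>s}.
        \<exists>e\<in>closure (dominant_chamber \<Phi> P). regular_point \<Phi> (angle_sum \<Phi> x (take i \<theta>s)) e)"

end

theory Submission
  imports Defs
begin

text \<open>
  Let \<open>e\<^sub>i\<close> be a regular dominant point of \<open>K\<^sub>i\<close>, the sum of the first \<open>i\<close> angle spaces. For a root
  \<open>\<gamma>\<close> that is not fixed by \<open>x\<close>, take the first \<open>i\<close> for which \<open>\<gamma>\<close> is not orthogonal to \<open>K\<^sub>i\<close>. Then the
  sign of \<open>x\<^sup>k(\<gamma>)\<close> is the sign of \<open>f(k) = (e\<^sub>i, x\<^sup>k(\<gamma>))\<close>, and
  \<open>f(k + 1) + f(k - 1) = 2 cos \<theta>\<^sub>i f(k)\<close>. As \<open>cos \<theta>\<^sub>i < 1\<close>, a periodic positive \<open>f\<close>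
  would violate this relation at its minimum, so \<open>\<gamma>\<close> leaves \<open>\<Phi>\<^sup>+\<close>. If \<open>\<alpha>\<close> and \<open>\<beta>\<close> have different
  levels \<open>i\<close>, the smaller one governs the signs of \<open>\<alpha> + \<beta>\<close>; if the levels agree, the convexity
  inequality is a Sturm-type comparison of two solutions of one recurrence.
\<close>

section \<open>Sturm comparison for second-order linear recurrences\<close>

text \<open>Two solutions of one recurrence have a constant Casoratian \<open>W\<close>. If
  \<open>W\<close> were nonnegative, positivity of \<open>b\<close> before \<open>n\<close> would
  keep \<open>a\<close> positive there as well, contradicting \<open>a m < 0\<close> when
  \<open>m < n\<close>. Once \<open>W < 0\<close>, the sum is negative at \<open>n\<close> or at
  \<open>n - 1\<close>.\<close>

lemma comparison_of_recurrences:
  fixes a b :: "nat \<Rightarrow> real"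
  assumes reca: "\<And>k. a (Suc (Suc k)) + a k = t * a (Suc k)"
    and recb: "\<And>k. b (Suc (Suc k)) + b k = t * b (Suc k)"
    and b_pos: "\<And>k. k < n \<Longrightarrow> 0 < b k" and bn: "b n < 0"
    and a0: "0 < a 0" and am: "a m < 0" and "m \<le> n"
  shows "\<exists>k\<in>{1..n}. a k + b k < 0"
proof -
  have "m \<noteq> 0" using a0 am by (metis less_asym)
  then obtain l where n: "n = Suc l" using \<open>m \<le> n\<close> by (cases n) auto
  show ?thesis
  proof (cases "m = n")
    case True
    then show ?thesis using am bn n by (intro bexI[of _ n]) auto
  next
    case False
    \<comment> \<open>The discrete Wronskian of \<open>a\<close> and \<open>b\<close>, taken at
      index 0.\<close>
    define W where "W = a 1 * b 0 - a 0 * b 1"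
    have cas: "a (Suc k) * b k - a k * b (Suc k) = W" for k
    proof (induction k)
      case (Suc k)
      have next_a: "a (Suc (Suc k)) = t * a (Suc k) - a k"
        and next_b: "b (Suc (Suc k)) = t * b (Suc k) - b k"
        using reca[of k] recb[of k] by auto
      show ?case unfolding next_a next_b using Suc by (simp add: algebra_simps)
    qed (simp add: W_def)
    have "W < 0"
    proof (rule ccontr)
      assume "\<not> W < 0"
      have "k < n \<Longrightarrow> 0 < a k" for k
      proof (induction k)
        case (Suc k)
        then have "0 < a k * b (Suc k)" using b_pos by simp
        then have "0 < a (Suc k) * b k" using cas[of k] \<open>\<not> W < 0\<close> by linarith
        then show ?case using b_pos[of k] Suc.prems by (simp add: zero_less_mult_iff)
      qed (use a0 in simp)
      then show False using am False \<open>m \<le> n\<close> by (metis le_neq_implies_less less_asym)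
    qed
    have bl: "0 < b l" using b_pos n by simp
    show ?thesis
    proof (cases "0 \<le> a l + b l")
      case True
      \<comment> \<open>Constancy of the Casoratian at \<open>l = n - 1\<close> replaces
        \<open>a n * b l\<close> by \<open>W + a l * b n\<close>.\<close>
      have "(a n + b n) * b l = W + (a l + b l) * b n"
        using cas[of l] n by (simp add: algebra_simps)
      also have "\<dots> < 0"
        using mult_nonneg_nonpos[OF True, of "b n"] bn \<open>W < 0\<close> by simp
      finally have "a n + b n < 0" using bl by (simp add: mult_less_0_iff)
      then show ?thesis using n by (intro bexI[of _ n]) auto
    next
      case neg: False
      \<comment> \<open>The sum is positive at 0, so its negative value at \<open>l\<close> occurs
        inside the required range.\<close>
      then have "l \<noteq> 0" using a0 bl by (metis add_pos_pos less_imp_le)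
      then show ?thesis using neg n by (intro bexI[of _ l]) auto
    qed
  qed
qed

section \<open>Root systems and positive systems\<close>

lemma root_system_uminus:
  assumes "root_system \<Phi>" "\<alpha> \<in> \<Phi>"
  shows "- \<alpha> \<in> \<Phi>"
proof -
  have "\<alpha> \<noteq> 0" using assms by (auto simp: root_system_def)
  then have "root_reflection \<alpha> \<alpha> = - \<alpha>"
    by (simp add: root_reflection_def scaleR_2)
  then show ?thesis using assms unfolding root_system_def by (metis imageI)
qed

lemma positive_system_subset: "positive_system \<Phi> P \<Longrightarrow> P \<subseteq> \<Phi>"
  by (auto simp: positive_system_def)

lemma positive_system_uminus_iff:
  assumes "root_system \<Phi>" "positive_system \<Phi> P" "\<alpha> \<in> \<Phi>"
  shows "- \<alpha> \<in> P \<longleftrightarrow> \<alpha> \<notin> P"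
  using assms root_system_uminus[OF assms(1,3)] unfolding positive_system_def
  by (metis (no_types, lifting) inner_minus_right linorder_neqE_linordered_idom mem_Collect_eq
      neg_0_less_iff_less not_less_iff_gr_or_eq)

lemma mem_uminus_image: "\<alpha> \<in> uminus ` P \<longleftrightarrow> - \<alpha> \<in> P" for \<alpha> :: "'a::group_add"
  by force

text \<open>Induction on the number of positive roots with smaller \<open>\<rho>\<close>-value. A
  positive root that is not simple splits into two positive roots, and both have smaller
  \<open>\<rho>\<close>-value because \<open>\<rho>\<close> is positive on each.\<close>

lemma positive_root_simple_sum:
  assumes "root_system \<Phi>" "positive_system \<Phi> P" "\<alpha> \<in> P"
  shows "\<exists>c :: 'v::euclidean_space \<Rightarrow> nat. \<alpha> = (\<Sum>\<beta>\<in>simple_roots P. of_nat (c \<beta>) *\<^sub>R \<beta>)"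
proof -
  obtain \<rho> where \<rho>: "P = {\<alpha>\<in>\<Phi>. \<rho> \<bullet> \<alpha> > 0}"
    using assms(2) by (auto simp: positive_system_def)
  have fin: "finite P" using assms(1) \<rho> by (auto simp: root_system_def)
  then have finS: "finite (simple_roots P)" by (simp add: simple_roots_def)
  show ?thesis using assms(3)
  proof (induction "card {\<beta>\<in>P. \<rho> \<bullet> \<beta> < \<rho> \<bullet> \<alpha>}" arbitrary: \<alpha> rule: less_induct)
    case less
    show ?case
    proof (cases "\<alpha> \<in> simple_roots P")
      case True
      then have "\<alpha> = (\<Sum>\<beta>\<in>simple_roots P. if \<beta> = \<alpha> then \<beta> else 0)"
        using finS by simp
      also have "\<dots> = (\<Sum>\<beta>\<in>simple_roots P. of_nat (if \<beta> = \<alpha> then 1 else 0) *\<^sub>R \<beta>)"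
        by (rule sum.cong) auto
      finally show ?thesis by (intro exI[of _ "\<lambda>\<beta>. if \<beta> = \<alpha> then 1 else 0"])
    next
      case False
      then obtain \<beta> \<gamma> where bg: "\<beta> \<in> P" "\<gamma> \<in> P" "\<alpha> = \<beta> + \<gamma>"
        using less.prems by (auto simp: simple_roots_def)
      have smaller: "card {\<beta>\<in>P. \<rho> \<bullet> \<beta> < \<rho> \<bullet> \<mu>} < card {\<beta>\<in>P. \<rho> \<bullet> \<beta> < \<rho> \<bullet> \<alpha>}"
        if "\<mu> \<in> P" "\<rho> \<bullet> \<mu> < \<rho> \<bullet> \<alpha>" for \<mu>
        using that fin by (intro psubset_card_mono) auto
      have "\<rho> \<bullet> \<beta> < \<rho> \<bullet> \<alpha>" "\<rho> \<bullet> \<gamma> < \<rho> \<bullet> \<alpha>"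
        using bg \<rho> by (auto simp: inner_add_right)
      then obtain c d :: "'v \<Rightarrow> nat" where
        c: "\<beta> = (\<Sum>\<mu>\<in>simple_roots P. of_nat (c \<mu>) *\<^sub>R \<mu>)" and
        d: "\<gamma> = (\<Sum>\<mu>\<in>simple_roots P. of_nat (d \<mu>) *\<^sub>R \<mu>)"
        using less.hyps[OF smaller] bg by meson
      have "\<alpha> = (\<Sum>\<mu>\<in>simple_roots P. of_nat (c \<mu> + d \<mu>) *\<^sub>R \<mu>)"
        unfolding bg(3) by (subst c, subst d) (simp add: scaleR_add_left sum.distrib)
      then show ?thesis by (intro exI[of _ "\<lambda>\<mu>. c \<mu> + d \<mu>"])
    qed
  qed
qed

text \<open>A dominant vector pairs nonnegatively with every term of a sum of simple roots. If it
  kills a positive root, it therefore kills each simple root occurring in it, so only simple roots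
  orthogonal to \<open>e\<close> occur. Negative roots follow by changing signs.\<close>

lemma standard_parabolic_orthogonal:
  fixes \<Phi> P :: "'v::euclidean_space set"
  assumes rs: "root_system \<Phi>" and ps: "positive_system \<Phi> P"
    and dom: "\<And>\<alpha>. \<alpha> \<in> P \<Longrightarrow> 0 \<le> e \<bullet> \<alpha>"
  shows "standard_parabolic_subsystem \<Phi> P {\<gamma>\<in>\<Phi>. e \<bullet> \<gamma> = 0}"
proof -
  define J where "J = {\<beta>\<in>simple_roots P. e \<bullet> \<beta> = 0}"
  have fin: "finite (simple_roots P)"
    using rs positive_system_subset[OF ps]
    by (auto simp: root_system_def simple_roots_def intro: finite_subset)
  have pos: "\<exists>c. \<gamma> = (\<Sum>\<beta>\<in>J. of_int (c \<beta>) *\<^sub>R \<beta>)" if g: "\<gamma> \<in> P" "e \<bullet> \<gamma> = 0" for \<gamma>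
  proof -
    obtain c :: "'v \<Rightarrow> nat" where c: "\<gamma> = (\<Sum>\<beta>\<in>simple_roots P. of_nat (c \<beta>) *\<^sub>R \<beta>)"
      using positive_root_simple_sum[OF rs ps g(1)] by blast
    have nn: "0 \<le> of_nat (c \<beta>) * (e \<bullet> \<beta>)" if "\<beta> \<in> simple_roots P" for \<beta>
      using that dom[of \<beta>] by (simp add: simple_roots_def)
    have "(\<Sum>\<beta>\<in>simple_roots P. of_nat (c \<beta>) * (e \<bullet> \<beta>)) = 0"
      using g(2) by (subst (asm) c) (simp add: inner_sum_right)
    then have zero: "\<forall>\<beta>\<in>simple_roots P. of_nat (c \<beta>) * (e \<bullet> \<beta>) = 0"
      using sum_nonneg_eq_0_iff[OF fin nn] by simp
    have "\<gamma> = (\<Sum>\<beta>\<in>J. of_nat (c \<beta>) *\<^sub>R \<beta>)"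
      by (subst c, rule sum.mono_neutral_right) (use fin zero in \<open>auto simp: J_def\<close>)
    then show ?thesis by (intro exI[of _ "\<lambda>\<beta>. int (c \<beta>)"]) simp
  qed
  have "\<gamma> \<in> int_span J" if g: "\<gamma> \<in> \<Phi>" "e \<bullet> \<gamma> = 0" for \<gamma>
  proof (cases "\<gamma> \<in> P")
    case True
    then show ?thesis using pos g by (auto simp: int_span_def)
  next
    case False
    then have "- \<gamma> \<in> P" using positive_system_uminus_iff[OF rs ps g(1)] by simp
    then obtain c where "- \<gamma> = (\<Sum>\<beta>\<in>J. of_int (c \<beta>) *\<^sub>R \<beta>)" using pos[of "- \<gamma>"] g by auto
    then have "\<gamma> = (\<Sum>\<beta>\<in>J. of_int (- c \<beta>) *\<^sub>R \<beta>)"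
      by (simp add: sum_negf) (metis minus_minus)
    then show ?thesis unfolding int_span_def by (intro CollectI exI[of _ "\<lambda>\<beta>. - c \<beta>"]) simp
  qed
  moreover have "e \<bullet> \<gamma> = 0" if "\<gamma> \<in> int_span J" for \<gamma>
    using that by (auto simp: int_span_def inner_sum_right J_def)
  ultimately have "{\<gamma>\<in>\<Phi>. e \<bullet> \<gamma> = 0} = \<Phi> \<inter> int_span J" by blast
  then show ?thesis
    unfolding standard_parabolic_subsystem_def J_def by (intro exI[of _ J]) (auto simp: J_def)
qed

text \<open>The span and the half-spaces given by positive roots are closed, so weak inequalities
  survive the closure.\<close>

lemma closure_dominant_chamber:
  assumes "e \<in> closure (dominant_chamber \<Phi> P)"
  shows "e \<in> span \<Phi>" and "\<alpha> \<in> P \<Longrightarrow> 0 \<le> e \<bullet> \<alpha>"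
proof -
  have "closure (dominant_chamber \<Phi> P) \<subseteq> span \<Phi>"
    by (rule closure_minimal) (auto simp: dominant_chamber_def closed_span)
  then show "e \<in> span \<Phi>" using assms by blast
next
  assume "\<alpha> \<in> P"
  have "closure (dominant_chamber \<Phi> P) \<subseteq> {v. \<alpha> \<bullet> v \<ge> 0}"
    using \<open>\<alpha> \<in> P\<close> closed_halfspace_ge[of 0 \<alpha>]
    by (intro closure_minimal) (auto simp: dominant_chamber_def inner_commute less_imp_le)
  then show "0 \<le> e \<bullet> \<alpha>" using assms by (auto simp: inner_commute)
qed

section \<open>Isometries\<close>

lemma orthogonal_transformation_inv_simps:
  fixes x :: "'v::euclidean_space \<Rightarrow> 'v"
  assumes "orthogonal_transformation x"
  shows "x (inv x v) = v" and "inv x (x v) = v"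
  using orthogonal_transformation_bij[OF assms]
  by (simp_all add: bij_is_surj surj_f_inv_f bij_is_inj)

lemma orthogonal_transformation_adjoint:
  fixes x :: "'v::euclidean_space \<Rightarrow> 'v"
  assumes "orthogonal_transformation x"
  shows "u \<bullet> x v = inv x u \<bullet> v" and "u \<bullet> inv x v = x u \<bullet> v"
  using assms orthogonal_transformation_inv_simps(1)[OF assms]
  unfolding orthogonal_transformation_def by metis+

lemma orthogonal_transformation_root_reflection: "orthogonal_transformation (root_reflection \<alpha>)"
proof -
  have "linear (root_reflection \<alpha>)"
    by (rule linearI)
      (simp_all add: root_reflection_def algebra_simps inner_add_left add_divide_distrib)
  moreover have "root_reflection \<alpha> v \<bullet> root_reflection \<alpha> w = v \<bullet> w" for v w
  proof (cases "\<alpha> = 0")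
    case False
    then show ?thesis
      by (simp add: root_reflection_def inner_diff_left inner_diff_right inner_commute field_simps)
  qed (simp add: root_reflection_def)
  ultimately show ?thesis by (simp add: orthogonal_transformation_def)
qed

lemma orthogonal_transformation_funpow:
  fixes f :: "'v::euclidean_space \<Rightarrow> 'v"
  shows "orthogonal_transformation f \<Longrightarrow> orthogonal_transformation (f ^^ n)"
proof (induction n)
  case 0
  then show ?case using orthogonal_transformation_id by (simp add: id_def)
next
  case (Suc n)
  then show ?case
    unfolding funpow.simps(2) by (blast intro: orthogonal_transformation_compose)
qed

lemma funpow_image_eq: "f ` A = A \<Longrightarrow> (f ^^ n) ` A = A"
proof (induction n)
  case (Suc n)
  then show ?case unfolding funpow.simps(2) image_comp[symmetric] by simp
qed simp

lemma inv_image_eq: "bij f \<Longrightarrow> f ` A = A \<Longrightarrow> inv f ` A = A"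
  by (metis bij_is_inj image_inv_f_f)

lemma weyl_group_isometry:
  assumes "root_system \<Phi>" "w \<in> weyl_group \<Phi>"
  shows "orthogonal_transformation w \<and> w ` \<Phi> = \<Phi>"
  using assms(2)
proof induction
  case (weyl_step \<alpha> w)
  have "root_reflection \<alpha> ` w ` \<Phi> = \<Phi>"
    using assms(1) weyl_step by (simp add: root_system_def)
  then show ?case
    using orthogonal_transformation_compose[OF orthogonal_transformation_root_reflection] weyl_step
    unfolding image_comp by blast
qed (simp add: id_def orthogonal_transformation_id)

text \<open>Passes from the twisted Weyl group to isometries that permute the roots, a class in
  which \<open>x\<close> and \<open>inv x\<close> can be treated alike.\<close>

lemma twisted_weyl_group_isometry:
  assumes "root_system \<Phi>" "based_automorphism \<Phi> P \<delta>" "x \<in> twisted_weyl_group \<Phi> \<delta>"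
  shows "orthogonal_transformation x" and "x ` \<Phi> = \<Phi>"
proof -
  obtain w i where x: "x = w \<circ> zpow \<delta> i" and w: "w \<in> weyl_group \<Phi>"
    using assms(3) by (auto simp: twisted_weyl_group_def)
  have d: "orthogonal_transformation \<delta>" "\<delta> ` \<Phi> = \<Phi>"
    using assms(2) by (auto simp: based_automorphism_def)
  have "orthogonal_transformation (zpow \<delta> i)" "zpow \<delta> i ` \<Phi> = \<Phi>"
    using d inv_image_eq[OF orthogonal_transformation_bij[OF d(1)] d(2)]
    by (simp_all add: zpow_def funpow_image_eq orthogonal_transformation_funpow
        orthogonal_transformation_inv)
  then show "orthogonal_transformation x" "x ` \<Phi> = \<Phi>"
    using weyl_group_isometry[OF assms(1) w]
    unfolding x image_comp[symmetric] by (auto intro: orthogonal_transformation_compose)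
qed

section \<open>Dominant points along a flag of invariant subspaces\<close>

text \<open>
  Here \<open>K i\<close> is the sum of the first \<open>i\<close> angle spaces, \<open>e i\<close> is a regular dominant point of
  \<open>K (Suc i)\<close>, and \<open>c i\<close> is the cosine of the angle added in step \<open>i\<close>, counted from \<open>0\<close>.
\<close>

locale good_flag =
  fixes \<Phi> P :: "'v::euclidean_space set" and x :: "'v \<Rightarrow> 'v"
    and r :: nat and K :: "nat \<Rightarrow> 'v set" and e :: "nat \<Rightarrow> 'v" and c :: "nat \<Rightarrow> real"
  assumes root_system: "root_system \<Phi>" and positive_system: "positive_system \<Phi> P"
    and orth: "orthogonal_transformation x" and image: "x ` \<Phi> = \<Phi>"
    and K_0: "K 0 = {0}"
    and K_mono: "i \<le> j \<Longrightarrow> j \<le> r \<Longrightarrow> K i \<subseteq> K j"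
    and K_x: "i \<le> r \<Longrightarrow> v \<in> K i \<Longrightarrow> x v \<in> K i"
    and K_inv: "i \<le> r \<Longrightarrow> v \<in> K i \<Longrightarrow> inv x v \<in> K i"
    and K_split: "i < r \<Longrightarrow> v \<in> K (Suc i) \<Longrightarrow>
      \<exists>a\<in>K i. \<exists>b. v = a + b \<and> x b + inv x b = (2 * c i) *\<^sub>R b"
    and e_K: "i < r \<Longrightarrow> e i \<in> K (Suc i)"
    and e_regular: "i < r \<Longrightarrow> \<gamma> \<in> \<Phi> \<Longrightarrow> e i \<bullet> \<gamma> = 0 \<Longrightarrow> \<gamma> \<in> (K (Suc i))\<^sup>\<bottom>"
    and e_dominant: "i < r \<Longrightarrow> \<gamma> \<in> P \<Longrightarrow> 0 \<le> e i \<bullet> \<gamma>"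
    and fixed_iff: "\<gamma> \<in> \<Phi> \<Longrightarrow> (\<forall>i<r. e i \<bullet> \<gamma> = 0) \<longleftrightarrow> x \<gamma> = \<gamma>"
    and c_less: "i < r \<Longrightarrow> c i < 1"
begin

section \<open>Levels of roots and signs along an orbit\<close>

text \<open>For a root, being nonzero on \<open>e i\<close> amounts to not being orthogonal to
  \<open>K (Suc i)\<close>, by regularity of \<open>e i\<close>. A relation is used because roots
  fixed by \<open>x\<close> have no level.\<close>

definition level :: "'v \<Rightarrow> nat \<Rightarrow> bool" where
  "level \<gamma> i \<longleftrightarrow> \<gamma> \<in> \<Phi> \<and> i < r \<and> \<gamma> \<in> (K i)\<^sup>\<bottom> \<and> e i \<bullet> \<gamma> \<noteq> 0"

lemma level_exists:
  assumes "\<gamma> \<in> \<Phi>" "x \<gamma> \<noteq> \<gamma>"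
  obtains i where "level \<gamma> i"
proof -
  define i where "i = (LEAST i. i < r \<and> e i \<bullet> \<gamma> \<noteq> 0)"
  have ex: "\<exists>i. i < r \<and> e i \<bullet> \<gamma> \<noteq> 0" using fixed_iff assms by blast
  have i: "i < r" "e i \<bullet> \<gamma> \<noteq> 0" using LeastI_ex[OF ex] by (auto simp: i_def)
  have "\<gamma> \<in> (K i)\<^sup>\<bottom>"
  proof (cases i)
    case 0
    then show ?thesis by (simp add: K_0 orthogonal_comp_def orthogonal_def)
  next
    case (Suc j)
    \<comment> \<open>Minimality of \<open>i = Suc j\<close> gives this; since \<open>e j\<close> is
      regular in \<open>K (Suc j) = K i\<close>, vanishing at one point becomes orthogonality to all
      of \<open>K i\<close>.\<close>
    then have "e j \<bullet> \<gamma> = 0" 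
      using not_less_Least[of j "\<lambda>i. i < r \<and> e i \<bullet> \<gamma> \<noteq> 0"] i(1) by (simp add: i_def[symmetric])
    then show ?thesis using e_regular[of j] Suc i assms by simp
  qed
  then show ?thesis using that i assms by (auto simp: level_def)
qed

lemma x_orthogonal_comp: "i \<le> r \<Longrightarrow> v \<in> (K i)\<^sup>\<bottom> \<Longrightarrow> x v \<in> (K i)\<^sup>\<bottom>"
  using K_inv orthogonal_transformation_adjoint(1)[OF orth]
  by (auto simp: orthogonal_comp_def orthogonal_def)

text \<open>If \<open>e i\<close> were orthogonal to \<open>x \<gamma>\<close>, regularity would
  make all of \<open>K (Suc i)\<close> orthogonal to \<open>x \<gamma>\<close>, including
  \<open>x (e i)\<close>; but \<open>x\<close> is an isometry. Hence a single vector
  \<open>e i\<close> decides the signs along the whole orbit.\<close>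

lemma level_x:
  assumes "level \<gamma> i"
  shows "level (x \<gamma>) i"
proof -
  have "x \<gamma> \<in> \<Phi>" using assms image by (auto simp: level_def)
  moreover have "e i \<bullet> x \<gamma> \<noteq> 0"
  proof
    assume "e i \<bullet> x \<gamma> = 0"
    then have "x \<gamma> \<in> (K (Suc i))\<^sup>\<bottom>" using e_regular assms \<open>x \<gamma> \<in> \<Phi>\<close> by (auto simp: level_def)
    moreover have "x (e i) \<in> K (Suc i)" using assms K_x e_K by (simp add: level_def)
    ultimately have "x (e i) \<bullet> x \<gamma> = 0" by (auto simp: orthogonal_comp_def orthogonal_def)
    then show False using assms orth by (simp add: level_def orthogonal_transformation_def)
  qed
  ultimately show ?thesis using assms x_orthogonal_comp by (simp add: level_def)
qed

lemma level_funpow: "level \<gamma> i \<Longrightarrow> level ((x ^^ k) \<gamma>) i"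
  by (induction k) (auto intro: level_x)

text \<open>Dominance of \<open>e i\<close> gives the weak inequalities, and the level excludes the
  value zero.\<close>

lemma level_sign:
  assumes "level \<gamma> i"
  shows "\<gamma> \<in> P \<longleftrightarrow> 0 < e i \<bullet> \<gamma>" and "\<gamma> \<in> uminus ` P \<longleftrightarrow> e i \<bullet> \<gamma> < 0"
proof -
  have g: "\<gamma> \<in> \<Phi>" "i < r" "e i \<bullet> \<gamma> \<noteq> 0" using assms by (auto simp: level_def)
  have "\<gamma> \<in> P \<Longrightarrow> 0 < e i \<bullet> \<gamma>" "- \<gamma> \<in> P \<Longrightarrow> e i \<bullet> \<gamma> < 0"
    using g e_dominant[of i \<gamma>] e_dominant[of i "- \<gamma>"] by auto
  then show "\<gamma> \<in> P \<longleftrightarrow> 0 < e i \<bullet> \<gamma>" and "\<gamma> \<in> uminus ` P \<longleftrightarrow> e i \<bullet> \<gamma> < 0"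
    using positive_system_uminus_iff[OF root_system positive_system g(1)]
    unfolding mem_uminus_image by (metis less_asym)+
qed

text \<open>The component of \<open>e i\<close> in \<open>K i\<close> is invisible to
  \<open>u\<close> and its iterates. The remaining component \<open>b\<close> satisfies the angle
  relation, which is carried over to \<open>u\<close> because the adjoint of \<open>x\<close> is
  \<open>inv x\<close>.\<close>

lemma level_recurrence:
  assumes "i < r" "u \<in> (K i)\<^sup>\<bottom>"
  shows "e i \<bullet> x (x u) + e i \<bullet> u = 2 * c i * (e i \<bullet> x u)"
proof -
  obtain a b where ab: "a \<in> K i" "e i = a + b" "x b + inv x b = (2 * c i) *\<^sub>R b"
    using K_split[OF assms(1) e_K[OF assms(1)]] by blast
  have perp: "x u \<in> (K i)\<^sup>\<bottom>" "x (x u) \<in> (K i)\<^sup>\<bottom>"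
    using assms x_orthogonal_comp by auto
  have "a \<bullet> u = 0" "a \<bullet> x u = 0" "a \<bullet> x (x u) = 0"
    using ab(1) perp assms(2) by (auto simp: orthogonal_comp_def orthogonal_def)
  moreover have "b \<bullet> x (x u) = inv x b \<bullet> x u"
    by (rule orthogonal_transformation_adjoint(1)[OF orth])
  moreover have "b \<bullet> u = x b \<bullet> x u" using orth by (simp add: orthogonal_transformation_def)
  ultimately have "e i \<bullet> x (x u) + e i \<bullet> u = (x b + inv x b) \<bullet> x u" "e i \<bullet> x u = b \<bullet> x u"
    using ab(2) by (simp_all add: inner_add_left)
  then show ?thesis using ab(3) by simp
qed

text \<open>Minimum principle on the finite orbit: if \<open>e i\<close> were positive throughout,
  then at a minimum the two neighbours would add up to at least twice the minimum, while the
  recurrence with \<open>c i < 1\<close> makes their sum smaller.\<close>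

lemma leaves_positive:
  assumes "\<gamma> \<in> P" "x \<gamma> \<noteq> \<gamma>"
  obtains k where "1 \<le> k" "(x ^^ k) \<gamma> \<in> uminus ` P"
proof -
  have "\<gamma> \<in> \<Phi>" using assms(1) positive_system positive_system_subset by blast
  then obtain i where lev: "level \<gamma> i" using level_exists assms(2) by blast
  then have i: "i < r" by (simp add: level_def)
  define orbit where orbit_def: "orbit = range (\<lambda>k. (x ^^ k) \<gamma>)"
  have orbit_level: "level v i" if "v \<in> orbit" for v using that level_funpow[OF lev] by (auto simp: orbit_def)
  have fin: "finite orbit"
    using orbit_level root_system finite_subset[of orbit \<Phi>] by (auto simp: root_system_def level_def)
  have sub: "x ` orbit \<subseteq> orbit"
    unfolding orbit_def by (auto intro: range_eqI[of _ _ "Suc _"] simp del: funpow.simps simp: funpow.simps(2))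
  \<comment> \<open>The orbit consists of forward iterates only; injectivity and finiteness supply
    the predecessor of the minimum.\<close>
  then have surj: "x ` orbit = orbit"
    using endo_inj_surj[OF fin sub] orthogonal_transformation_inj[OF orth]
    by (meson inj_on_subset subset_UNIV)
  have "\<exists>v\<in>orbit. e i \<bullet> v < 0"
  proof (rule ccontr)
    assume neg: "\<not> (\<exists>v\<in>orbit. e i \<bullet> v < 0)"
    obtain v where v: "v \<in> orbit" "\<And>w. w \<in> orbit \<Longrightarrow> e i \<bullet> v \<le> e i \<bullet> w"
      using ex_min_if_finite[OF finite_imageI[OF fin, of "\<lambda>v. e i \<bullet> v"]]
      by (metis (no_types, lifting) orbit_def empty_not_UNIV image_is_empty imageE imageI not_le)
    obtain u where u: "u \<in> orbit" "v = x u" using surj v(1) by blast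
    have "e i \<bullet> x v + e i \<bullet> u = 2 * c i * (e i \<bullet> v)"
      using level_recurrence[OF i, of u] orbit_level[OF u(1)] u(2) by (simp add: level_def)
    moreover have "e i \<bullet> v \<le> e i \<bullet> x v" "e i \<bullet> v \<le> e i \<bullet> u" using v u sub by auto
    \<comment> \<open>The orbit stays at level \<open>i\<close>, so the nonnegative minimum cannot
      be zero; strictness is needed to multiply \<open>c i < 1\<close>.\<close>
    moreover have "0 < e i \<bullet> v" using neg v(1) orbit_level[OF v(1)] by (force simp: level_def)
    then have "c i * (e i \<bullet> v) < 1 * (e i \<bullet> v)" using c_less[OF i] by (rule mult_strict_right_mono[rotated])
    ultimately show False by simp
  qed
  then obtain k where k: "e i \<bullet> (x ^^ k) \<gamma> < 0" by (auto simp: orbit_def)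
  then have "k \<noteq> 0" using level_sign(1)[OF lev] assms(1) by (cases k) auto
  then show ?thesis using that[of k] level_sign(2)[OF level_funpow[OF lev, of k]] k by simp
qed

text \<open>A root that is not fixed leaves its sign class under forward iterates; for negative
  roots this is applied to \<open>- \<gamma>\<close>. A fixed root keeps its sign under all integer
  iterates.\<close>

lemma Phi_of_eq: "Phi_of P x = {\<alpha>\<in>\<Phi>. x \<alpha> = \<alpha>}"
proof (intro subset_antisym subsetI)
  fix \<gamma> assume g: "\<gamma> \<in> Phi_of P x"
  have disj: "\<alpha> \<in> P \<Longrightarrow> \<alpha> \<notin> uminus ` P" for \<alpha>
    using positive_system_uminus_iff[OF root_system positive_system, of \<alpha>]
      positive_system_subset[OF positive_system]
    unfolding mem_uminus_image by blast
  have pow: "(x ^^ k) \<alpha> \<in> Q" if "\<alpha> \<in> stable_roots Q x" for k \<alpha> Q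
  proof -
    have "zpow x (int k) \<alpha> \<in> Q" using that by (auto simp: stable_roots_def)
    then show ?thesis by (simp add: zpow_def)
  qed
  consider "\<gamma> \<in> stable_roots P x" | "\<gamma> \<in> stable_roots (uminus ` P) x"
    using g by (auto simp: Phi_of_def)
  then show "\<gamma> \<in> {\<alpha>\<in>\<Phi>. x \<alpha> = \<alpha>}"
  proof cases
    case 1
    then have "\<gamma> \<in> P" by (simp add: stable_roots_def)
    moreover have "x \<gamma> = \<gamma>"
    proof (rule ccontr)
      assume "x \<gamma> \<noteq> \<gamma>"
      then obtain k where "(x ^^ k) \<gamma> \<in> uminus ` P" using leaves_positive \<open>\<gamma> \<in> P\<close> by blast
      then show False using disj pow[OF 1] by blast
    qed
    ultimately show ?thesis using positive_system_subset[OF positive_system] by blast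
  next
    case 2
    then have m: "- \<gamma> \<in> P" by (auto simp: stable_roots_def)
    have lin: "(x ^^ k) (- \<gamma>) = - (x ^^ k) \<gamma>" for k
      using orthogonal_transformation_funpow[OF orth]
      by (simp add: orthogonal_transformation_def linear_neg)
    have "x (- \<gamma>) = - \<gamma>"
    proof (rule ccontr)
      assume "x (- \<gamma>) \<noteq> - \<gamma>"
      then obtain k where "(x ^^ k) (- \<gamma>) \<in> uminus ` P" using leaves_positive m by blast
      then have "(x ^^ k) \<gamma> \<in> P" unfolding lin mem_uminus_image by simp
      then show False using disj pow[OF 2] by blast
    qed
    then show ?thesis
      using lin[of 1] root_system_uminus[OF root_system, of "- \<gamma>"] m
        positive_system_subset[OF positive_system] by auto
  qed
next
  fix \<gamma> assume g: "\<gamma> \<in> {\<alpha>\<in>\<Phi>. x \<alpha> = \<alpha>}"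
  have pow_fixed: "f \<gamma> = \<gamma> \<Longrightarrow> (f ^^ k) \<gamma> = \<gamma>" for f k by (induction k) auto
  have "inv x \<gamma> = \<gamma>" using g orthogonal_transformation_inv_simps(2)[OF orth, of \<gamma>] by simp
  then have "zpow x i \<gamma> = \<gamma>" for i using g by (simp add: zpow_def pow_fixed)
  then show "\<gamma> \<in> Phi_of P x"
    using g positive_system_uminus_iff[OF root_system positive_system, of \<gamma>]
    unfolding Phi_of_def stable_roots_def mem_uminus_image by auto
qed

section \<open>First exit times and their behaviour under addition\<close>

lemma n_of_positive:
  assumes "\<gamma> \<in> P" "x \<gamma> \<noteq> \<gamma>"
  shows "n_of P x \<gamma> = enat (LEAST k. 1 \<le> k \<and> (x ^^ k) \<gamma> \<in> uminus ` P)"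
proof -
  have "\<gamma> \<notin> uminus ` P"
    using assms(1) positive_system_uminus_iff[OF root_system positive_system, of \<gamma>]
      positive_system_subset[OF positive_system] unfolding mem_uminus_image by blast
  then show ?thesis using assms Phi_of_eq by (simp add: n_of_def)
qed

lemma n_of_cases:
  assumes "\<gamma> \<in> P" "x \<gamma> \<noteq> \<gamma>"
  obtains n where "n_of P x \<gamma> = enat n" "1 \<le> n" "(x ^^ n) \<gamma> \<in> uminus ` P"
    "\<And>k. k < n \<Longrightarrow> (x ^^ k) \<gamma> \<in> P"
proof -
  define n where "n = (LEAST k. 1 \<le> k \<and> (x ^^ k) \<gamma> \<in> uminus ` P)"
  have "\<exists>k. 1 \<le> k \<and> (x ^^ k) \<gamma> \<in> uminus ` P" using leaves_positive[OF assms] by metis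
  from LeastI_ex[OF this] have n: "1 \<le> n" "(x ^^ n) \<gamma> \<in> uminus ` P"
    by (simp_all add: n_def)
  have "(x ^^ k) \<gamma> \<in> P" if "k < n" for k
  \<comment> \<open>The minimum runs over \<open>k \<ge> 1\<close>; index 0 is covered by
    \<open>\<gamma> \<in> P\<close>.\<close>
  proof (cases "k = 0")
    case False
    then have "(x ^^ k) \<gamma> \<notin> uminus ` P" 
      using not_less_Least[of k "\<lambda>k. 1 \<le> k \<and> (x ^^ k) \<gamma> \<in> uminus ` P"] that
      by (simp add: n_def)
    moreover have "(x ^^ k) \<gamma> \<in> \<Phi>"
      using funpow_image_eq[OF image, of k] assms(1) positive_system_subset[OF positive_system]
      by blast
    ultimately show ?thesis
      using positive_system_uminus_iff[OF root_system positive_system]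
      unfolding mem_uminus_image by blast
  qed (use assms in simp)
  then show ?thesis using that n n_of_positive[OF assms] by (simp add: n_def)
qed

lemma n_of_le:
  assumes "\<gamma> \<in> P" "1 \<le> k" "(x ^^ k) \<gamma> \<in> uminus ` P"
  shows "n_of P x \<gamma> \<le> enat k"
proof -
  have "x \<gamma> \<noteq> \<gamma>"
  proof
    assume "x \<gamma> = \<gamma>"
    then have "(x ^^ k) \<gamma> = \<gamma>" by (induction k) auto
    then show False
      using assms positive_system_uminus_iff[OF root_system positive_system, of \<gamma>]
        positive_system_subset[OF positive_system] unfolding mem_uminus_image by auto
  qed
  then show ?thesis using assms by (simp add: n_of_positive Least_le)
qed

text \<open>The vector \<open>e i\<close> lies in \<open>K (Suc i)\<close>, hence in
  \<open>K j\<close>, to which the whole orbit of \<open>\<beta>\<close> is orthogonal. So a root of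
  higher level does not affect the signs read off by \<open>e i\<close>.\<close>

lemma level_inner_funpow_eq_0:
  assumes "level \<beta> j" "i < j"
  shows "e i \<bullet> (x ^^ k) \<beta> = 0"
proof -
  have "j \<le> r" using assms(1) by (simp add: level_def)
  then have "e i \<in> K j" using e_K[of i] K_mono[of "Suc i" j] assms(2) by auto
  then show ?thesis using level_funpow[OF assms(1), of k]
    by (auto simp: level_def orthogonal_comp_def orthogonal_def)
qed

lemma funpow_add: "(x ^^ k) (\<alpha> + \<beta>) = (x ^^ k) \<alpha> + (x ^^ k) \<beta>"
  using orthogonal_transformation_funpow[OF orth]
  by (simp add: orthogonal_transformation_def linear_add)

text \<open>Positivity of both roots prevents cancellation at \<open>e i\<close>.\<close>

lemma level_add:
  assumes "level \<alpha> i" "level \<beta> j" "i \<le> j" "\<alpha> \<in> P" "\<beta> \<in> P" "\<alpha> + \<beta> \<in> P"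
  shows "level (\<alpha> + \<beta>) i"
proof -
  have "\<beta> \<in> (K i)\<^sup>\<bottom>"
    using assms(2,3) K_mono[of i j] by (auto simp: level_def orthogonal_comp_def)
  then have "\<alpha> + \<beta> \<in> (K i)\<^sup>\<bottom>"
    using assms(1) by (auto simp: level_def orthogonal_comp_def orthogonal_def inner_add_right)
  moreover have "0 \<le> e i \<bullet> \<beta>" "0 < e i \<bullet> \<alpha>"
    using assms e_dominant level_sign(1)[OF assms(1)] by (auto simp: level_def)
  ultimately show ?thesis
    using assms positive_system_subset[OF positive_system] by (auto simp: level_def inner_add_right)
qed

lemma n_of_add_le_aux:
  assumes "level \<alpha> i" "level \<beta> j" "i \<le> j" "\<alpha> \<in> P" "\<beta> \<in> P" "\<alpha> + \<beta> \<in> P"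
    and moved: "x \<alpha> \<noteq> \<alpha>" "x \<beta> \<noteq> \<beta>"
  shows "n_of P x (\<alpha> + \<beta>) \<le> max (n_of P x \<alpha>) (n_of P x \<beta>)"
proof -
  obtain n where n: "n_of P x \<alpha> = enat n" "1 \<le> n" "(x ^^ n) \<alpha> \<in> uminus ` P"
    "\<And>k. k < n \<Longrightarrow> (x ^^ k) \<alpha> \<in> P" using n_of_cases assms by blast
  obtain m where m: "n_of P x \<beta> = enat m" "1 \<le> m" "(x ^^ m) \<beta> \<in> uminus ` P"
    "\<And>k. k < m \<Longrightarrow> (x ^^ k) \<beta> \<in> P" using n_of_cases assms by blast
  have lev: "level (\<alpha> + \<beta>) i" using level_add assms by blast
  define a where "a k = e i \<bullet> (x ^^ k) \<alpha>" for k
  define b where "b k = e i \<bullet> (x ^^ k) \<beta>" for k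
  \<comment> \<open>As \<open>\<alpha> + \<beta>\<close> has level \<open>i\<close>, a negative
    value of \<open>a k + b k\<close> means that it has become negative at time
    \<open>k\<close>.\<close>
  have "\<exists>k\<in>{1..max n m}. a k + b k < 0"
  proof (cases "i = j")
    case False
    then have "b n = 0" using level_inner_funpow_eq_0[OF assms(2)] assms(3) by (simp add: b_def)
    moreover have "a n < 0" using level_sign(2)[OF level_funpow[OF assms(1)]] n(3) by (simp add: a_def)
    ultimately show ?thesis using n(2) by (intro bexI[of _ n]) auto
  next
    case True
    have rec: "e i \<bullet> (x ^^ Suc (Suc k)) \<gamma> + e i \<bullet> (x ^^ k) \<gamma> = 2 * c i * (e i \<bullet> (x ^^ Suc k) \<gamma>)"
      if "level \<gamma> i" for \<gamma> k
      using level_recurrence[of i "(x ^^ k) \<gamma>"] level_funpow[OF that, of k] by (simp add: level_def)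
    have b_level: "level \<beta> i" using assms(2) True by simp
    note sgn_a = level_sign[OF level_funpow[OF assms(1)]]
    note sgn_b = level_sign[OF level_funpow[OF b_level]]
    have a: "\<And>k. k < n \<Longrightarrow> 0 < a k" "a n < 0" and b: "\<And>k. k < m \<Longrightarrow> 0 < b k" "b m < 0"
      using n(3,4) m(3,4) sgn_a sgn_b by (auto simp: a_def b_def)
    have rec_a: "a (Suc (Suc k)) + a k = 2 * c i * a (Suc k)"
      and rec_b: "b (Suc (Suc k)) + b k = 2 * c i * b (Suc k)" for k
      unfolding a_def b_def by (rule rec[OF assms(1)], rule rec[OF b_level])
    show ?thesis
    \<comment> \<open>The sequence with the later exit time takes the role of \<open>b\<close> in
      the comparison, since it is positive on the whole range before that time.\<close>
    proof (cases "n \<le> m")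
      case True
      then show ?thesis
        using comparison_of_recurrences[where a = a and b = b and n = m and m = n, OF rec_a rec_b b]
          a n(2) by (simp add: max_def)
    next
      case False
      then show ?thesis
        using comparison_of_recurrences[where a = b and b = a and n = n and m = m, OF rec_b rec_a a]
          b m(2)
        by (simp add: max_def add.commute)
    qed
  qed
  then obtain k where k: "1 \<le> k" "k \<le> max n m" "a k + b k < 0" by auto
  then have "(x ^^ k) (\<alpha> + \<beta>) \<in> uminus ` P"
    using level_sign(2)[OF level_funpow[OF lev]]
    by (simp add: funpow_add inner_add_right a_def b_def)
  then have "n_of P x (\<alpha> + \<beta>) \<le> enat k" using n_of_le assms(6) k(1) by blast
  also have "\<dots> \<le> max (enat n) (enat m)" using k(2) by (simp add: le_max_iff_disj)
  finally show ?thesis using n(1) m(1) by simp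
qed

lemma n_of_add_le:
  assumes "\<alpha> \<in> P" "\<beta> \<in> P" "\<alpha> + \<beta> \<in> P"
  shows "n_of P x (\<alpha> + \<beta>) \<le> max (n_of P x \<alpha>) (n_of P x \<beta>)"
\<comment> \<open>A fixed summand has exit time \<open>\<infinity>\<close>, which makes the bound
  trivial.\<close>
proof (cases "x \<alpha> = \<alpha> \<or> x \<beta> = \<beta>")
  case True
  then have "\<alpha> \<in> Phi_of P x \<or> \<beta> \<in> Phi_of P x"
    using Phi_of_eq assms positive_system_subset[OF positive_system] by blast
  then show ?thesis by (auto simp: n_of_def)
next
  case False
  then obtain i j where ij: "level \<alpha> i" "level \<beta> j"
    using level_exists assms positive_system_subset[OF positive_system] by (metis subsetD)
  show ?thesis
  proof (cases "i \<le> j")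
    case True
    then show ?thesis using n_of_add_le_aux[OF ij] False assms by blast
  next
    case ji: False
    then show ?thesis
      using n_of_add_le_aux[OF ij(2,1)] False assms by (simp add: add.commute max.commute)
  qed
qed

text \<open>On a positive root the values of the \<open>e i\<close> are nonnegative, so their sum
  \<open>s\<close> vanishes only if each of them does. Thus the fixed roots are those orthogonal to
  the single dominant vector \<open>s\<close>, and they form a standard parabolic subsystem.\<close>

lemma quasi_convex: "quasi_convex \<Phi> P x"
proof -
  define s where "s = (\<Sum>i<r. e i)"
  have "(s \<bullet> \<gamma> = 0) = (x \<gamma> = \<gamma>)" if g: "\<gamma> \<in> \<Phi>" for \<gamma>
  proof -
    have pos: "(s \<bullet> \<gamma> = 0) = (\<forall>i<r. e i \<bullet> \<gamma> = 0)" if "\<gamma> \<in> P" for \<gamma>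
      using sum_nonneg_eq_0_iff[of "{..<r}" "\<lambda>i. e i \<bullet> \<gamma>"] e_dominant that
      by (auto simp: s_def inner_sum_left)
    have "(s \<bullet> \<gamma> = 0) = (\<forall>i<r. e i \<bullet> \<gamma> = 0)"
    proof (cases "\<gamma> \<in> P")
      case False
      then show ?thesis
        using pos[of "- \<gamma>"] positive_system_uminus_iff[OF root_system positive_system g] by simp
    qed (rule pos)
    then show ?thesis using fixed_iff[OF g] by simp
  qed
  then have "{\<gamma>\<in>\<Phi>. s \<bullet> \<gamma> = 0} = Phi_of P x" unfolding Phi_of_eq by blast
  moreover have "standard_parabolic_subsystem \<Phi> P {\<gamma>\<in>\<Phi>. s \<bullet> \<gamma> = 0}"
    by (rule standard_parabolic_orthogonal[OF root_system positive_system])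
      (auto simp: s_def inner_sum_left intro!: sum_nonneg e_dominant)
  ultimately show ?thesis unfolding quasi_convex_def using n_of_add_le by auto
qed

end

section \<open>Good position elements\<close>

lemma angle_sum_Nil [simp]: "angle_sum \<Phi> x [] = {0}"
  by (simp add: angle_sum_def)

lemma angle_sum_snoc:
  "angle_sum \<Phi> x (\<theta>s @ [\<theta>]) = angle_sum \<Phi> x \<theta>s + angle_space \<Phi> x \<theta>"
  by (simp add: angle_sum_def)

lemma zero_in_angle_space:
  assumes "orthogonal_transformation x"
  shows "0 \<in> angle_space \<Phi> x \<theta>"
  using assms orthogonal_transformation_inv[OF assms]
  by (simp add: angle_space_def span_zero orthogonal_transformation_def linear_0)

lemma angle_sum_take_mono:
  assumes "orthogonal_transformation x" "i \<le> j"
  shows "angle_sum \<Phi> x (take i \<theta>s) \<subseteq> angle_sum \<Phi> x (take j \<theta>s)"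
  using assms(2)
proof (induction rule: dec_induct)
  case (step n)
  have "angle_sum \<Phi> x (take n \<theta>s) \<subseteq> angle_sum \<Phi> x (take (Suc n) \<theta>s)"
  proof (cases "n < length \<theta>s")
    case True
    then show ?thesis
      using set_zero_plus2[OF zero_in_angle_space[OF assms(1)]]
      by (simp add: take_Suc_conv_app_nth angle_sum_snoc
          add.commute[of "angle_sum \<Phi> x (take n \<theta>s)"])
  qed simp
  then show ?case using step by blast
qed simp

lemma angle_sum_induct [consumes 1, case_names zero add]:
  assumes "v \<in> angle_sum \<Phi> x \<theta>s" and "Q 0"
    and "\<And>a b \<theta>. Q a \<Longrightarrow> \<theta> \<in> set \<theta>s \<Longrightarrow> b \<in> angle_space \<Phi> x \<theta> \<Longrightarrow> Q (a + b)"
  shows "Q v"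
  using assms(1,3)
proof (induction \<theta>s arbitrary: v rule: rev_induct)
  case (snoc \<theta> \<theta>s)
  from snoc.prems(1) obtain a b where
    ab: "v = a + b" "a \<in> angle_sum \<Phi> x \<theta>s" "b \<in> angle_space \<Phi> x \<theta>"
    by (auto simp: angle_sum_snoc elim: set_plus_elim)
  have "Q a" by (rule snoc.IH[OF ab(2)], rule snoc.prems(2)) auto
  from snoc.prems(2)[OF this _ ab(3)] show ?case by (simp add: ab(1))
qed (use assms(2) in simp)

text \<open>Stated for a general linear map so that it serves both \<open>x\<close> and
  \<open>inv x\<close>.\<close>

lemma angle_sum_image_subset:
  assumes y: "linear y" and "\<And>\<theta> v. v \<in> angle_space \<Phi> x \<theta> \<Longrightarrow> y v \<in> angle_space \<Phi> x \<theta>"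
    and "v \<in> angle_sum \<Phi> x \<theta>s"
  shows "y v \<in> angle_sum \<Phi> x \<theta>s"
  using assms(3)
proof (induction \<theta>s arbitrary: v rule: rev_induct)
  case (snoc \<theta> \<theta>s)
  then show ?case
    using assms(2) linear_add[OF y] by (auto simp: angle_sum_snoc intro!: set_plus_intro elim!: set_plus_elim)
qed (simp add: linear_0[OF y])

lemma linear_image_span:
  assumes "linear y" "y ` \<Phi> = \<Phi>" "v \<in> span \<Phi>"
  shows "y v \<in> span \<Phi>"
  using assms linear_span_image[OF assms(1), of \<Phi>] by (metis imageI)

lemma angle_space_x:
  assumes "orthogonal_transformation x" "x ` \<Phi> = \<Phi>" "v \<in> angle_space \<Phi> x \<theta>"
  shows "x v \<in> angle_space \<Phi> x \<theta>"
proof -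
  have lin: "linear x" using assms(1) by (simp add: orthogonal_transformation_def)
  have "x (x v + inv x v) = x ((2 * cos \<theta>) *\<^sub>R v)" using assms(3) by (simp add: angle_space_def)
  then have "x (x v) + inv x (x v) = (2 * cos \<theta>) *\<^sub>R x v"
    by (simp add: linear_add[OF lin] linear_cmul[OF lin] orthogonal_transformation_inv_simps[OF assms(1)])
  then show ?thesis
    using assms(3) linear_image_span[OF lin assms(2)] by (simp add: angle_space_def)
qed

section \<open>Symmetry under passing to the inverse\<close>

text \<open>The defining relation is symmetric in \<open>x\<close> and \<open>inv x\<close>;
  admissibility and good position inherit this symmetry.\<close>

lemma angle_space_inv:
  assumes "orthogonal_transformation x"
  shows "angle_space \<Phi> (inv x) = angle_space \<Phi> x"
  using inv_inv_eq[OF orthogonal_transformation_bij[OF assms]]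
  by (auto simp: angle_space_def add.commute)

lemma fixed_space_inv:
  assumes "orthogonal_transformation x"
  shows "fixed_space \<Phi> (inv x) = fixed_space \<Phi> x"
  using orthogonal_transformation_inv_simps[OF assms] by (auto simp: fixed_space_def) metis+

lemma admissible_inv:
  assumes "orthogonal_transformation x"
  shows "admissible \<Phi> (inv x) \<theta>s = admissible \<Phi> x \<theta>s"
proof -
  have "inv x v = v \<longleftrightarrow> x v = v" for v
    using orthogonal_transformation_inv_simps[OF assms] by metis
  then show ?thesis
    by (simp add: admissible_def angle_sum_def angle_space_inv[OF assms] fixed_space_inv[OF assms])
qed

lemma good_position_inv:
  assumes "orthogonal_transformation x"
  shows "good_position \<Phi> P (inv x) \<theta>s = good_position \<Phi> P x \<theta>s"
  by (simp add: good_position_def angle_sum_def angle_space_inv[OF assms])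

section \<open>Angle sums and fixed vectors\<close>

lemma cos_less_1: "\<theta> \<in> {0<..pi} \<Longrightarrow> cos \<theta> < 1"
  using cos_monotone_0_pi[of 0 \<theta>] by simp

text \<open>Eigenvectors of the self-adjoint map \<open>x + inv x\<close> for distinct eigenvalues
  are orthogonal: a fixed vector has eigenvalue 2, and \<open>2 * cos \<theta>\<close> is
  smaller.\<close>

lemma angle_sum_orthogonal_fixed:
  assumes "orthogonal_transformation x" "set \<theta>s \<subseteq> {0<..pi}" "x u = u" "v \<in> angle_sum \<Phi> x \<theta>s"
  shows "v \<bullet> u = 0"
  using assms(4)
proof (induction rule: angle_sum_induct)
  case (add a b \<theta>)
  have "inv x u = u" using assms(3) orthogonal_transformation_inv_simps(2)[OF assms(1), of u] by simp
  then have "(x b + inv x b) \<bullet> u = 2 * (b \<bullet> u)"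
    using assms(3) orthogonal_transformation_adjoint[OF assms(1), of b u]
    by (simp add: inner_add_left)
  then have "cos \<theta> * (b \<bullet> u) = b \<bullet> u" using add by (simp add: angle_space_def)
  then have "b \<bullet> u = 0" using cos_less_1[of \<theta>] add assms(2) by force
  then show ?case using add by (simp add: inner_add_left)
qed simp

lemma angle_sum_subset_span: "v \<in> angle_sum \<Phi> x \<theta>s \<Longrightarrow> v \<in> span \<Phi>"
  by (induction rule: angle_sum_induct) (auto simp: span_zero span_add angle_space_def)

text \<open>The regular point supplied by admissibility lies in the angle sum, so it is orthogonal
  to \<open>\<gamma>\<close>. Regularity extends this to the whole complement of the fixed space,
  and \<open>\<gamma>\<close> has no component there.\<close>

lemma orthogonal_admissible_imp_fixed:
  assumes orth: "orthogonal_transformation x" and adm: "admissible \<Phi> x \<theta>s"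
    and g: "\<gamma> \<in> \<Phi>" "\<gamma> \<in> (angle_sum \<Phi> x \<theta>s)\<^sup>\<bottom>"
  shows "x \<gamma> = \<gamma>"
proof (cases "\<theta>s = []")
  case True
  then show ?thesis using adm g by (simp add: admissible_def span_base)
next
  case False
  let ?F = "fixed_space \<Phi> x"
  obtain e where e: "e \<in> angle_sum \<Phi> x \<theta>s" "regular_point \<Phi> (span \<Phi> \<inter> ?F\<^sup>\<bottom>) e"
    using adm False by (auto simp: admissible_def)
  have "e \<bullet> \<gamma> = 0" using e(1) g by (simp add: orthogonal_comp_def orthogonal_def)
  then have perp: "v \<bullet> \<gamma> = 0" if "v \<in> span \<Phi>" "v \<in> ?F\<^sup>\<bottom>" for v
    using e g(1) angle_sum_subset_span[OF e(1)] that
    by (auto simp: regular_point_def root_hyperplane_def)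
  have lin: "linear x" using orth by (simp add: orthogonal_transformation_def)
  have sub: "subspace ?F"
    by (rule subspaceI)
      (auto simp: fixed_space_def span_zero span_add span_scale
        linear_0[OF lin] linear_add[OF lin] linear_cmul[OF lin])
  obtain p q where pq: "p \<in> ?F" "\<And>w. w \<in> ?F \<Longrightarrow> orthogonal q w" "\<gamma> = p + q"
    using orthogonal_subspace_decomp_exists[of ?F \<gamma>] sub by (metis span_eq_iff)
  have "q = \<gamma> - p" using pq by simp
  then have "q \<in> span \<Phi>" using g(1) pq(1) by (simp add: span_base span_diff fixed_space_def)
  moreover have "q \<in> ?F\<^sup>\<bottom>" using pq(2) by (auto simp: orthogonal_comp_def orthogonal_commute)
  \<comment> \<open>Since \<open>q\<close> is orthogonal to \<open>p\<close>, this number is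
    \<open>q \<bullet> q\<close>.\<close>
  ultimately have "q \<bullet> \<gamma> = 0" by (rule perp)
  then have "q = 0" using pq by (simp add: inner_add_right orthogonal_def)
  then show ?thesis using pq by (simp add: fixed_space_def)
qed

lemma good_position_quasi_convex:
  fixes \<Phi> P :: "'v::euclidean_space set"
  assumes rs: "root_system \<Phi>" and ps: "positive_system \<Phi> P"
    and orth: "orthogonal_transformation x" and im: "x ` \<Phi> = \<Phi>"
    and adm: "admissible \<Phi> x \<theta>s" and good: "good_position \<Phi> P x \<theta>s"
  shows "quasi_convex \<Phi> P x" and "Phi_of P x = {\<alpha>\<in>\<Phi>. x \<alpha> = \<alpha>}"
proof -
  define K where "K i = angle_sum \<Phi> x (take i \<theta>s)" for i
  \<comment> \<open>Good position counts from 1 and the flag from 0, whence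
    \<open>K (Suc i)\<close>.\<close>
  have "\<forall>i<length \<theta>s. \<exists>e. e \<in> closure (dominant_chamber \<Phi> P) \<and> regular_point \<Phi> (K (Suc i)) e"
    using good by (fastforce simp: good_position_def K_def)
  then obtain e where dom: "\<And>i. i < length \<theta>s \<Longrightarrow> e i \<in> closure (dominant_chamber \<Phi> P)"
    and reg: "\<And>i. i < length \<theta>s \<Longrightarrow> regular_point \<Phi> (K (Suc i)) (e i)"
    by metis
  have lin: "linear x" "linear (inv x)"
    using orth orthogonal_transformation_inv[OF orth] by (auto simp: orthogonal_transformation_def)
  have pi: "set \<theta>s \<subseteq> {0<..pi}" using adm by (simp add: admissible_def)
  have inv_im: "inv x ` \<Phi> = \<Phi>" using inv_image_eq orthogonal_transformation_bij orth im by blast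
  have regular: "\<gamma> \<in> (K (Suc i))\<^sup>\<bottom>" if "i < length \<theta>s" "\<gamma> \<in> \<Phi>" "e i \<bullet> \<gamma> = 0" for i \<gamma>
  proof -
    \<comment> \<open>Hyperplanes are cut out inside \<open>span \<Phi>\<close>, which contains the
      closed chamber.\<close>
    have "e i \<in> root_hyperplane \<Phi> \<gamma>"
      using closure_dominant_chamber(1)[OF dom] that by (simp add: root_hyperplane_def)
    then have "K (Suc i) \<subseteq> root_hyperplane \<Phi> \<gamma>"
      using reg[OF that(1)] that(2) by (simp add: regular_point_def)
    then show ?thesis by (auto simp: root_hyperplane_def orthogonal_comp_def orthogonal_def)
  qed
  interpret good_flag \<Phi> P x "length \<theta>s" K e "\<lambda>i. cos (\<theta>s ! i)"
  proof
    show "\<exists>a\<in>K i. \<exists>b. v = a + b \<and> x b + inv x b = (2 * cos (\<theta>s ! i)) *\<^sub>R b"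
      if "i < length \<theta>s" "v \<in> K (Suc i)" for i v
      using that
      by (auto simp: K_def take_Suc_conv_app_nth angle_sum_snoc angle_space_def elim!: set_plus_elim)
    show "x v \<in> K i" if "v \<in> K i" for v i
      unfolding K_def
      by (rule angle_sum_image_subset[OF lin(1) _ that[unfolded K_def]]) (rule angle_space_x[OF orth im])
    show "inv x v \<in> K i" if "v \<in> K i" for v i
      using that angle_space_x[OF orthogonal_transformation_inv[OF orth] inv_im]
      unfolding K_def angle_space_inv[OF orth] by (metis angle_sum_image_subset[OF lin(2)])
    show "(\<forall>i<length \<theta>s. e i \<bullet> \<gamma> = 0) \<longleftrightarrow> x \<gamma> = \<gamma>" if "\<gamma> \<in> \<Phi>" for \<gamma>
    proof
      assume zero: "\<forall>i<length \<theta>s. e i \<bullet> \<gamma> = 0"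
      have "\<gamma> \<in> (K (length \<theta>s))\<^sup>\<bottom>"
      proof (cases "length \<theta>s")
        case 0
        then show ?thesis by (simp add: K_def orthogonal_comp_def orthogonal_def)
      next
        case (Suc j)
        then show ?thesis using regular[of j] zero that by simp
      qed
      then show "x \<gamma> = \<gamma>" using orthogonal_admissible_imp_fixed[OF orth adm that] by (simp add: K_def)
    next
      assume "x \<gamma> = \<gamma>"
      moreover have "e i \<in> K (Suc i)" if "i < length \<theta>s" for i
        using reg[OF that] by (simp add: regular_point_def)
      ultimately show "\<forall>i<length \<theta>s. e i \<bullet> \<gamma> = 0"
        using angle_sum_orthogonal_fixed[OF orth subset_trans[OF set_take_subset pi]]
        unfolding K_def by blast
    qed
    show "cos (\<theta>s ! i) < 1" if "i < length \<theta>s" for i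
      using cos_less_1 pi that nth_mem by blast
  qed (use rs ps orth im regular reg closure_dominant_chamber(2)[OF dom]
      angle_sum_take_mono[OF orth] in \<open>auto simp: K_def regular_point_def\<close>)
  show "quasi_convex \<Phi> P x" by (rule quasi_convex)
  show "Phi_of P x = {\<alpha>\<in>\<Phi>. x \<alpha> = \<alpha>}" by (rule Phi_of_eq)
qed

theorem theorem3p4:
  fixes \<Phi> P :: "'v::euclidean_space set"
    and \<delta> x :: "'v \<Rightarrow> 'v"
    and \<theta>s :: "real list"
  assumes "root_system \<Phi>"
    and "positive_system \<Phi> P"
    and "based_automorphism \<Phi> P \<delta>"
    and "x \<in> twisted_weyl_group \<Phi> \<delta>"
    and "admissible \<Phi> x \<theta>s"
    and "good_position \<Phi> P x \<theta>s"
  shows "convex_element \<Phi> P x \<and> Phi_of P x = {\<alpha>\<in>\<Phi>. x \<alpha> = \<alpha>}"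
proof -
  have orth: "orthogonal_transformation x" and im: "x ` \<Phi> = \<Phi>"
    using twisted_weyl_group_isometry assms by blast+
  have inv_im: "inv x ` \<Phi> = \<Phi>"
    using inv_image_eq orthogonal_transformation_bij[OF orth] im by blast
  \<comment> \<open>The same angles and the same dominant points serve \<open>inv x\<close>, because
    its angle spaces and fixed space are those of \<open>x\<close>.\<close>
  have "quasi_convex \<Phi> P (inv x)"
    using assms(5,6) good_position_quasi_convex(1)[OF assms(1,2)
        orthogonal_transformation_inv[OF orth] inv_im]
    by (simp add: admissible_inv[OF orth] good_position_inv[OF orth])
  then show ?thesis
    using good_position_quasi_convex[OF assms(1,2) orth im assms(5,6)]
    by (simp add: convex_element_def)
qed

end
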